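(* For any Bell scenario, i.e. any finite nonempty sets $S,T,A,B$, with $N=|S||A|+|T||B|$, we have $\mathcal Q\subseteq\mathrm{Corr}(\mathcal{DNN}^N)\subseteq\mathcal{NS}$.
   Context: $\mathcal{P}$: vectors $p=(p(a,b|s,t))_{a\in A,b\in B,s\in S,t\in T}$ with $p(a,b|s,t)\ge 0$ and $\sum_{a,b}p(a,b|s,t)=1$ for all $s,t$. $\mathcal{Q}$: $p\in\mathcal P$ such that there are finite-dimensional complex Euclidean spaces $\mathcal X,\mathcal Y$, a unit vector $\psi\in\mathcal X\otimes\mathcal Y$, Hermitian psd operators $X_a^s$ on $\mathcal X$ with $\sum_{a\in A} X_a^s=\mathbb I_{\mathcal X}$ for each $s$, and Hermitian psd operators $Y_b^t$ on $\mathcal Y$ with $\sum_{b\in B} Y_b^t=\mathbb I_{\mathcal Y}$ for each $t$, with $p(a,b|s,t)=\psi^*(X_a^s\otimes Y_b^t)\psi$ for all $a,b,s,t$. $\mathcal{NS}$: $p\in\mathcal P$ with $\sum_b p(a,b|s,t)=\sum_b p(a,b|s,t')$ for all $a,s,t\neq t'$, and $\sum_a p(a,b|s,t)=\sum_a p(a,b|s',t)$ for all $b,t,s\ne s'$. $\mathcal{DNN}^n$ is the set of real symmetric psd $n\times n$ matrices with all entries nonnegative. Real symmetric $N\times N$ matrices are indexed by the disjoint union of $S\times A$ and $T\times B$ (in $S\cup T$, $S$ and $T$ are regarded as disjoint). $\langle J_{i,j},X\rangle:=\sum_{k,l}X[(i,k),(j,l)]$ is the sum of entries in block $(i,j)$,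 $i,j\in S\cup T$. $\mathrm{Corr}(\mathcal{DNN}^N)$ is the set of vectors $p=(p(a,b|s,t))$ for which there is $X\in\mathcal{DNN}^N$ with $\langle J_{i,j},X\rangle=1$ for all $i,j\in S\cup T$ and $X[(s,a),(t,b)]=p(a,b|s,t)$ for all $a,b,s,t$. *)

theory Defs
  imports
    "HOL-Analysis.Cartesian_Space"
    "Jordan_Normal_Form.Schur_Decomposition"
begin

text \<open>
  A Bell scenario is given by four finite nonempty sets, rendered as types
  \<open>'a\<close>, \<open>'b\<close> (outcomes) and \<open>'s\<close>, \<open>'t\<close> (questions) of class
  \<^class>\<open>finite\<close>. A value \<open>p a b s t\<close> stands for $p(a,b|s,t)$.
\<close>

type_synonym ('a, 'b, 's, 't) correlation = "'a \<Rightarrow> 'b \<Rightarrow> 's \<Rightarrow> 't \<Rightarrow> real"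

definition prob_correlations ::
    "('a::finite, 'b::finite, 's::finite, 't::finite) correlation set" where
  "prob_correlations =
     {p. (\<forall>a b s t. 0 \<le> p a b s t) \<and>
         (\<forall>s t. (\<Sum>a\<in>UNIV. \<Sum>b\<in>UNIV. p a b s t) = 1)}"

definition nonsignaling_correlations ::
    "('a::finite, 'b::finite, 's::finite, 't::finite) correlation set" where
  "nonsignaling_correlations =
     {p \<in> prob_correlations.
        (\<forall>a s t t'. t \<noteq> t' \<longrightarrow> (\<Sum>b\<in>UNIV. p a b s t) = (\<Sum>b\<in>UNIV. p a b s t')) \<and>
        (\<forall>b t s s'. s \<noteq> s' \<longrightarrow> (\<Sum>a\<in>UNIV. p a b s t) = (\<Sum>a\<in>UNIV. p a b s' t))}"


text \<open>
  The dimensions of the spaces $\mathcal X = \mathbb{C}^n$ and $\mathcal Y = \mathbb{C}^m$ are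
  existentially quantified in the definition of quantum correlations, so operators on them are
  matrices of the type \<^typ>\<open>complex Matrix.mat\<close>, whose dimension is not part of the type.
  The tensor product of $\mathbb{C}^n$ and $\mathbb{C}^m$ is $\mathbb{C}^{nm}$, the basis vector
  $e_i \otimes e_j$ being the unit vector with index \<open>i * m + j\<close>.
\<close>

definition kronecker_mat :: "complex Matrix.mat \<Rightarrow> complex Matrix.mat \<Rightarrow> complex Matrix.mat"
    (infixl \<open>\<otimes>\<^sub>K\<close> 70) where
  "A \<otimes>\<^sub>K B =
     Matrix.mat (dim_row A * dim_row B) (dim_col A * dim_col B)
       (\<lambda>(i, j). A $$ (i div dim_row B, j div dim_col B) * B $$ (i mod dim_row B, j mod dim_col B))"

text \<open>
  As \<open>u \<bullet>c v\<close> conjugates the entries of \<open>v\<close>, the number $v^* A v$ is \<open>(A *\<^sub>v v) \<bullet>c v\<close>; it is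
  real for Hermitian \<open>A\<close>.
\<close>

definition hermitian_psd :: "nat \<Rightarrow> complex Matrix.mat \<Rightarrow> bool" where
  "hermitian_psd n A \<longleftrightarrow>
     A \<in> carrier_mat n n \<and> mat_adjoint A = A \<and>
     (\<forall>v\<in>carrier_vec n. 0 \<le> Re ((A *\<^sub>v v) \<bullet>c v))"

text \<open>
  The sum of the operators is formed entrywise, since matrices of unspecified dimension have no
  \<open>0\<close> and hence do not admit \<^const>\<open>sum\<close>.
\<close>

definition measurement :: "nat \<Rightarrow> ('o::finite \<Rightarrow> complex Matrix.mat) \<Rightarrow> bool" where
  "measurement n M \<longleftrightarrow>
     (\<forall>o'. hermitian_psd n (M o')) \<and>
     Matrix.mat n n (\<lambda>ij. \<Sum>o'\<in>UNIV. M o' $$ ij) = 1\<^sub>m n"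

definition quantum_correlations ::
    "('a::finite, 'b::finite, 's::finite, 't::finite) correlation set" where
  "quantum_correlations =
     {p \<in> prob_correlations.
        \<exists>n m (\<psi> :: complex Matrix.vec) (X :: 's \<Rightarrow> 'a \<Rightarrow> complex Matrix.mat)
           (Y :: 't \<Rightarrow> 'b \<Rightarrow> complex Matrix.mat).
          \<psi> \<in> carrier_vec (n * m) \<and> \<psi> \<bullet>c \<psi> = 1 \<and>
          (\<forall>s. measurement n (X s)) \<and> (\<forall>t. measurement m (Y t)) \<and>
          (\<forall>a b s t. complex_of_real (p a b s t) = ((X s a \<otimes>\<^sub>K Y t b) *\<^sub>v \<psi>) \<bullet>c \<psi>)}"


text \<open>
  Real $n \times n$ matrices are indexed by a finite type \<open>'n\<close> with $n$ elements.
\<close>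

definition doubly_nonnegative :: "(real ^ 'n ^ 'n::finite) set" where
  "doubly_nonnegative =
     {X. Finite_Cartesian_Product.transpose X = X \<and> (\<forall>v. 0 \<le> inner v (X *v v)) \<and>
         (\<forall>i j. 0 \<le> vec_nth (vec_nth X i) j)}"

text \<open>The disjoint union of $S \times A$ and $T \times B$.\<close>

type_synonym ('a, 'b, 's, 't) block_index = "('s \<times> 'a) + ('t \<times> 'b)"

lemma card_block_index:
  "CARD(('a::finite, 'b::finite, 's::finite, 't::finite) block_index) =
     CARD('s) * CARD('a) + CARD('t) * CARD('b)"
  by simp

fun block :: "'s + 't \<Rightarrow> ('a::finite, 'b::finite, 's::finite, 't::finite) block_index set" where
  "block (Inl s) = {Inl (s, a) | a. True}"
| "block (Inr t) = {Inr (t, b) | b. True}"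

definition block_sum ::
    "'s + 't \<Rightarrow> 's + 't \<Rightarrow>
     real ^ ('a::finite, 'b::finite, 's::finite, 't::finite) block_index
          ^ ('a, 'b, 's, 't) block_index \<Rightarrow> real" where
  "block_sum i j X = (\<Sum>k\<in>block i. \<Sum>l\<in>block j. vec_nth (vec_nth X k) l)"

definition Corr ::
    "(real ^ ('a::finite, 'b::finite, 's::finite, 't::finite) block_index
           ^ ('a, 'b, 's, 't) block_index) set \<Rightarrow> ('a, 'b, 's, 't) correlation set" where
  "Corr K =
     {p. \<exists>X\<in>K. (\<forall>i j. block_sum i j X = 1) \<and>
         (\<forall>a b s t. vec_nth (vec_nth X (Inl (s, a))) (Inr (t, b)) = p a b s t)}"

end

theory Submission
  imports Defs
begin

text \<open>
  For \<open>\<Q> \<subseteq> Corr(DNN)\<close>, take a Schmidt decomposition of the state with coefficients \<open>\<sigma>\<^sub>l\<close> and bases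
  \<open>g\<^sub>l\<close>, \<open>f\<^sub>l\<close>. The matrices with entries \<open>\<surd>(\<sigma>\<^sub>l \<sigma>\<^sub>l\<^sub>') \<langle>g\<^sub>l, X g\<^sub>l\<^sub>'\<rangle>\<close> and the conjugates of
  \<open>\<surd>(\<sigma>\<^sub>l \<sigma>\<^sub>l\<^sub>') \<langle>f\<^sub>l, Y f\<^sub>l\<^sub>'\<rangle>\<close> are all positive semidefinite, so the Gram matrix of their Frobenius
  inner products is doubly nonnegative, including on the blocks of two operators of the same party
  (where the Gram matrix of the vectors \<open>(X \<otimes> I) \<psi>\<close> may have negative entries). Each measurement sums
  to \<open>diag(\<sigma>)\<close>, of Frobenius norm 1, which gives the block sums.

  For \<open>Corr(DNN) \<subseteq> \<N>\<S>\<close>, the quadratic form of \<open>X\<close> vanishes at the difference of the indicator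
  vectors of two blocks. Hence \<open>X\<close> annihilates that difference, so row sums over a block do not depend on the
  block.
\<close>

section \<open>Singular value decomposition\<close>

lemma trace_comm:
  fixes A B :: "nat \<Rightarrow> nat \<Rightarrow> 'a :: comm_semiring_0"
  shows "(\<Sum>i<n. \<Sum>j<m. A i j * B j i) = (\<Sum>j<m. \<Sum>i<n. B j i * A i j)"
  by (subst sum.swap) (simp add: mult.commute)

text \<open>Similarity preserves the trace, so a Schur triangular form of the matrix has a nonzero
  diagonal entry, and this entry is a root of the characteristic polynomial. Applied to L* L below,
  it supplies a singular vector of L.\<close>

lemma eigenvalue_of_trace:
  fixes A :: "nat \<Rightarrow> nat \<Rightarrow> complex"
  assumes tr: "(\<Sum>i<n. A i i) \<noteq> 0"
  obtains \<mu> v where "\<mu> \<noteq> 0" "\<exists>i<n. v i \<noteq> 0" "\<And>i. i < n \<Longrightarrow> (\<Sum>j<n. A i j * v j) = \<mu> * v i"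
proof -
  define M where "M = Matrix.mat n n (\<lambda>(i, j). A i j)"
  have M: "M \<in> carrier_mat n n" by (simp add: M_def)
  from char_poly_factorized[OF M] obtain es where es: "char_poly M = (\<Prod>a\<leftarrow>es. [:- a, 1:])" by blast
  obtain B P Q where sd: "schur_decomposition M es = (B, P, Q)" by (metis surj_pair)
  have sim: "similar_mat_wit M B P Q" and up: "upper_triangular B" and "diag_mat B = es"
    using schur_decomposition[OF M es sd] by auto
  note w = similar_mat_witD2[OF M sim]
  have trM: "(\<Sum>i<n. M $$ (i, i)) = (\<Sum>i<n. B $$ (i, i))"
  proof -
    have *: "(\<Sum>i<n. (X * Y) $$ (i, i)) = (\<Sum>i<n. (Y * X) $$ (i, i))"
      if "X \<in> carrier_mat n n" "Y \<in> carrier_mat n n" for X Y :: "complex Matrix.mat"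
    proof -
      have "(\<Sum>i<n. (X * Y) $$ (i, i)) = (\<Sum>i<n. \<Sum>j<n. X $$ (i, j) * Y $$ (j, i))"
        using that by (intro sum.cong) (auto simp: scalar_prod_def atLeast0LessThan)
      also have "\<dots> = (\<Sum>i<n. \<Sum>j<n. Y $$ (i, j) * X $$ (j, i))"
        by (rule trace_comm)
      also have "\<dots> = (\<Sum>i<n. (Y * X) $$ (i, i))"
        using that by (intro sum.cong) (auto simp: scalar_prod_def atLeast0LessThan)
      finally show ?thesis .
    qed
    have "(\<Sum>i<n. M $$ (i, i)) = (\<Sum>i<n. (P * (B * Q)) $$ (i, i))"
      using w by (simp add: assoc_mult_mat[of P n n B n Q n])
    also have "\<dots> = (\<Sum>i<n. ((B * Q) * P) $$ (i, i))"
      using w by (intro *) auto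
    also have "(B * Q) * P = B"
      using w by (simp add: assoc_mult_mat[of B n n Q n P n])
    finally show ?thesis .
  qed
  with tr have "(\<Sum>i<n. B $$ (i, i)) \<noteq> 0" by (simp add: M_def)
  then obtain i where i: "i < n" "B $$ (i, i) \<noteq> 0"
    by (metis (no_types, lifting) lessThan_iff sum.not_neutral_contains_not_neutral)
  define \<mu> where "\<mu> = B $$ (i, i)"
  have "poly (char_poly M) \<mu> = 0"
  proof -
    have "\<mu> \<in> set (diag_mat B)"
      using i w by (auto simp: diag_mat_def \<mu>_def)
    then show ?thesis using \<open>diag_mat B = es\<close> unfolding es poly_prod_list by (auto simp: prod_list_zero_iff image_iff)
  qed
  then obtain v where v: "eigenvector M v \<mu>"
    using eigenvalue_root_char_poly[OF M] eigenvalue_def by blast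
  have dv: "dim_vec v = n" and nz: "v \<noteq> 0\<^sub>v n" and ev: "M *\<^sub>v v = \<mu> \<cdot>\<^sub>v v"
    using v M by (auto simp: eigenvector_def)
  show thesis
  proof (rule that[of \<mu> "vec_index v"])
    show "\<mu> \<noteq> 0" using i by (simp add: \<mu>_def)
    show "\<exists>i<n. vec_index v i \<noteq> 0"
      using dv nz by (metis eq_vecI index_zero_vec)
    show "(\<Sum>j<n. A i j * vec_index v j) = \<mu> * vec_index v i" if "i < n" for i
    proof -
      have "vec_index (M *\<^sub>v v) i = vec_index (\<mu> \<cdot>\<^sub>v v) i" using ev by simp
      then show ?thesis using that dv by (simp add: M_def scalar_prod_def atLeast0LessThan)
    qed
  qed
qed

section \<open>Inner products, adjoints and orthonormal systems\<close>

text \<open>Vectors and matrices are plain functions on the naturals, with the dimensions passed as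
  arguments. Only values below the dimensions matter, so no carrier conditions arise.\<close>

definition cinner :: "nat \<Rightarrow> (nat \<Rightarrow> complex) \<Rightarrow> (nat \<Rightarrow> complex) \<Rightarrow> complex" where
  "cinner n u v = (\<Sum>i<n. u i * cnj (v i))"

definition apply_mat :: "nat \<Rightarrow> (nat \<Rightarrow> nat \<Rightarrow> complex) \<Rightarrow> (nat \<Rightarrow> complex) \<Rightarrow> nat \<Rightarrow> complex" where
  "apply_mat m K v i = (\<Sum>j<m. K i j * v j)"

definition adj :: "(nat \<Rightarrow> nat \<Rightarrow> complex) \<Rightarrow> nat \<Rightarrow> nat \<Rightarrow> complex" where
  "adj K j i = cnj (K i j)"

lemma cinner_cong:
  "(\<And>i. i < n \<Longrightarrow> u i = u' i) \<Longrightarrow> (\<And>i. i < n \<Longrightarrow> v i = v' i) \<Longrightarrow> cinner n u v = cinner n u' v'"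
  by (simp add: cinner_def)

lemma apply_mat_cong:
  "(\<And>j. j < m \<Longrightarrow> v j = v' j) \<Longrightarrow> apply_mat m K v i = apply_mat m K v' i"
  by (simp add: apply_mat_def)

lemma adj_adj [simp]: "adj (adj K) = K"
  by (simp add: adj_def fun_eq_iff)

lemma cinner_commute: "cinner n u v = cnj (cinner n v u)"
  by (simp add: cinner_def mult.commute)

lemma cinner_scale_left: "cinner n (\<lambda>i. c * u i) v = c * cinner n u v"
  by (simp add: cinner_def sum_distrib_left mult.assoc)

lemma cinner_scale_right: "cinner n u (\<lambda>i. c * v i) = cnj c * cinner n u v"
  by (simp add: cinner_def sum_distrib_left mult_ac)

lemma cinner_self: "cinner n u u = of_real (\<Sum>i<n. (cmod (u i))\<^sup>2)"
  by (simp add: cinner_def complex_norm_square del: of_real_power)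

lemma cinner_zero_left: "(\<And>i. i < n \<Longrightarrow> u i = 0) \<Longrightarrow> cinner n u v = 0"
  by (simp add: cinner_def)

lemma cinner_self_eq_0: "cinner n u u = 0 \<Longrightarrow> i < n \<Longrightarrow> u i = 0"
proof -
  assume "cinner n u u = 0" "i < n"
  then have "(\<Sum>i<n. (cmod (u i))\<^sup>2) = 0" by (simp only: cinner_self of_real_eq_0_iff)
  then show ?thesis using \<open>i < n\<close> by (subst (asm) sum_nonneg_eq_0_iff) auto
qed

lemma cinner_apply_mat: "cinner n (apply_mat m K v) w = cinner m v (apply_mat n (adj K) w)"
proof -
  have "cinner n (apply_mat m K v) w = (\<Sum>i<n. \<Sum>j<m. K i j * v j * cnj (w i))"
    by (simp add: cinner_def apply_mat_def sum_distrib_right)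
  also have "\<dots> = (\<Sum>j<m. \<Sum>i<n. K i j * v j * cnj (w i))"
    by (rule sum.swap)
  also have "\<dots> = cinner m v (apply_mat n (adj K) w)"
    by (simp add: cinner_def apply_mat_def adj_def sum_distrib_left mult_ac)
  finally show ?thesis .
qed

lemma apply_mat_scale: "apply_mat m K (\<lambda>j. c * v j) i = c * apply_mat m K v i"
  by (simp add: apply_mat_def sum_distrib_left mult_ac)

definition orthonormal :: "nat \<Rightarrow> nat \<Rightarrow> (nat \<Rightarrow> nat \<Rightarrow> complex) \<Rightarrow> bool" where
  "orthonormal n k g \<longleftrightarrow> (\<forall>l<k. \<forall>l'<k. cinner n (g l) (g l') = of_bool (l = l'))"

lemma orthonormal_extend:
  assumes "orthonormal n k g" "cinner n u u = 1" "\<And>l. l < k \<Longrightarrow> cinner n u (g l) = 0"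
  shows "orthonormal n (Suc k) (g(k := u))"
proof -
  have "cinner n (g l) u = 0" if "l < k" for l
    using assms(3)[OF that] cinner_commute[of n "g l" u] by simp
  then show ?thesis using assms by (auto simp: orthonormal_def less_Suc_eq)
qed

text \<open>The projection onto the span is Hermitian and idempotent, so its diagonal entries are at
  most 1, while its trace is \<open>k\<close>.\<close>

lemma orthonormal_card_le:
  assumes "orthonormal n k g"
  shows "k \<le> n"
proof -
  define P where "P i j = (\<Sum>l<k. g l i * cnj (g l j))" for i j
  have idem: "(\<Sum>q<n. P i q * P q i) = P i i" for i
  proof -
    have "(\<Sum>q<n. P i q * P q i) = (\<Sum>q<n. \<Sum>l<k. \<Sum>l'<k. g l i * cnj (g l' i) * (g l' q * cnj (g l q)))"
      unfolding P_def sum_product by (simp add: mult_ac)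
    also have "\<dots> = (\<Sum>l<k. \<Sum>l'<k. g l i * cnj (g l' i) * cinner n (g l') (g l))"
      by (subst sum.swap, rule sum.cong[OF refl], subst sum.swap)
         (simp add: cinner_def sum_distrib_left)
    also have "\<dots> = (\<Sum>l<k. \<Sum>l'<k. if l' = l then g l i * cnj (g l' i) else 0)"
      using assms by (intro sum.cong) (auto simp: orthonormal_def)
    also have "\<dots> = P i i" by (simp add: P_def)
    finally show ?thesis .
  qed
  have Pr: "P i i = of_real (\<Sum>l<k. (cmod (g l i))\<^sup>2)" for i
    by (simp add: P_def complex_norm_square del: of_real_power)
  define d where "d i = (\<Sum>l<k. (cmod (g l i))\<^sup>2)" for i
  have "d i \<le> 1" if "i < n" for i
  proof -
    have "P i q * P q i = of_real ((cmod (P i q))\<^sup>2)" for q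
      unfolding complex_norm_square by (simp add: P_def mult.commute)
    with idem[of i] have "of_real (d i) = (of_real (\<Sum>q<n. (cmod (P i q))\<^sup>2) :: complex)"
      by (simp only: d_def Pr of_real_sum)
    then have "d i = (\<Sum>q<n. (cmod (P i q))\<^sup>2)" by (simp only: of_real_eq_iff)
    \<comment> \<open>The term \<open>q = i\<close> of the sum is the square of \<open>d i\<close>,
      which yields \<open>d i * d i \<le> d i\<close>.\<close>
    also have "\<dots> \<ge> (cmod (P i i))\<^sup>2"
      using that by (intro member_le_sum) auto
    finally have "d i * d i \<le> d i"
      by (simp only: Pr d_def[symmetric] norm_of_real power2_abs) (simp add: power2_eq_square)
    moreover have "0 \<le> d i" by (simp add: d_def sum_nonneg)
    ultimately show ?thesis by (cases "d i = 0") (auto simp: mult_le_cancel_left2)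
  qed
  then have "(\<Sum>i<n. d i) \<le> (\<Sum>i<n. 1)" by (intro sum_mono) auto
  moreover have "(\<Sum>i<n. d i) = k"
  proof -
    have "complex_of_real (\<Sum>i<n. d i) = (\<Sum>l<k. cinner n (g l) (g l))"
      unfolding d_def by (subst sum.swap) (simp add: cinner_self)
    also have "\<dots> = of_nat k" using assms by (simp add: orthonormal_def)
    finally show ?thesis by (metis of_real_eq_iff of_real_of_nat_eq)
  qed
  ultimately show ?thesis by simp
qed

section \<open>Singular systems and deflation\<close>

text \<open>A partial singular value decomposition: \<open>k\<close> singular triples with positive
  singular values, not necessarily all of them, so that a system can be enlarged one triple at a
  time.\<close>

definition singular_system ::
  "nat \<Rightarrow> nat \<Rightarrow> (nat \<Rightarrow> nat \<Rightarrow> complex) \<Rightarrow> nat \<Rightarrow> (nat \<Rightarrow> real) \<Rightarrow>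
   (nat \<Rightarrow> nat \<Rightarrow> complex) \<Rightarrow> (nat \<Rightarrow> nat \<Rightarrow> complex) \<Rightarrow> bool" where
  "singular_system n m K k \<sigma> g h \<longleftrightarrow>
     (\<forall>l<k. 0 < \<sigma> l) \<and> orthonormal n k g \<and> orthonormal m k h \<and>
     (\<forall>l<k. \<forall>i<n. apply_mat m K (h l) i = \<sigma> l * g l i) \<and>
     (\<forall>l<k. \<forall>j<m. apply_mat n (adj K) (g l) j = \<sigma> l * h l j)"

lemma apply_mat_minus_rank_one_sum:
  "apply_mat m (\<lambda>i j. K i j - (\<Sum>l<k. of_real (\<sigma> l) * g l i * cnj (h l j))) v i =
   apply_mat m K v i - (\<Sum>l<k. of_real (\<sigma> l) * cinner m v (h l) * g l i)"
proof -
  have "(\<Sum>j<m. (\<Sum>l<k. of_real (\<sigma> l) * g l i * cnj (h l j)) * v j) =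
        (\<Sum>l<k. of_real (\<sigma> l) * cinner m v (h l) * g l i)"
    unfolding sum_distrib_right
    by (subst sum.swap) (simp add: cinner_def sum_distrib_left sum_distrib_right mult_ac)
  then show ?thesis by (simp add: apply_mat_def left_diff_distrib sum_subtractf)
qed

text \<open>Deflation: let L be \<open>K\<close> minus the part described by the given triples. If L
  has a nonzero entry, then L* L has a nonzero eigenvalue, and a normalized eigenvector for it gives
  a further singular triple of \<open>K\<close>.\<close>

lemma singular_system_extend:
  assumes sys: "singular_system n m K k \<sigma> g h"
    and ij: "i\<^sub>0 < n" "j\<^sub>0 < m" "K i\<^sub>0 j\<^sub>0 \<noteq> (\<Sum>l<k. of_real (\<sigma> l) * g l i\<^sub>0 * cnj (h l j\<^sub>0))"
  shows "\<exists>\<sigma> g h. singular_system n m K (Suc k) \<sigma> g h"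
proof -
  define L where "L = (\<lambda>i j. K i j - (\<Sum>l<k. of_real (\<sigma> l) * g l i * cnj (h l j)))"
  note L_apply = apply_mat_minus_rank_one_sum[of m K \<sigma> g h k, folded L_def]
  have adj_L: "adj L = (\<lambda>j i. adj K j i - (\<Sum>l<k. of_real (\<sigma> l) * h l j * cnj (g l i)))"
    by (simp add: L_def adj_def fun_eq_iff mult_ac)
  note adjL_apply = apply_mat_minus_rank_one_sum[of n "adj K" \<sigma> h g k, folded adj_L]
  have pos: "\<And>l. l < k \<Longrightarrow> 0 < \<sigma> l"
    and og: "\<And>l l'. l < k \<Longrightarrow> l' < k \<Longrightarrow> cinner n (g l) (g l') = of_bool (l = l')"
    and oh: "\<And>l l'. l < k \<Longrightarrow> l' < k \<Longrightarrow> cinner m (h l) (h l') = of_bool (l = l')"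
    and Kh: "\<And>l i. l < k \<Longrightarrow> i < n \<Longrightarrow> apply_mat m K (h l) i = \<sigma> l * g l i"
    and Kg: "\<And>l j. l < k \<Longrightarrow> j < m \<Longrightarrow> apply_mat n (adj K) (g l) j = \<sigma> l * h l j"
    using sys by (auto simp: singular_system_def orthonormal_def)
  \<comment> \<open>By orthonormality the subtracted part agrees with \<open>K\<close> on
    \<open>h l\<close>, and its adjoint agrees with \<open>adj K\<close> on \<open>g l\<close>;
    hence L and its adjoint annihilate the old vectors.\<close>
  have Lh: "apply_mat m L (h l) i = 0" if "l < k" "i < n" for l i
  proof -
    have "(\<Sum>l'<k. of_real (\<sigma> l') * cinner m (h l) (h l') * g l' i) =
          (\<Sum>l'<k. if l' = l then of_real (\<sigma> l') * g l' i else 0)"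
      using that oh by (intro sum.cong) auto
    then show ?thesis using that by (simp add: L_apply Kh)
  qed
  have Lg: "apply_mat n (adj L) (g l) j = 0" if "l < k" "j < m" for l j
  proof -
    have "(\<Sum>l'<k. of_real (\<sigma> l') * cinner n (g l) (g l') * h l' j) =
          (\<Sum>l'<k. if l' = l then of_real (\<sigma> l') * h l' j else 0)"
      using that og by (intro sum.cong) auto
    then show ?thesis using that by (simp add: adjL_apply Kg)
  qed
  \<comment> \<open>\<open>A\<close> is the matrix of L* L. Its trace is the squared Frobenius norm
    of L, which is positive because the entry at \<open>i\<^sub>0\<close>, \<open>j\<^sub>0\<close>
    is nonzero.\<close>
  define A where "A j j' = apply_mat n (adj L) (\<lambda>i. L i j') j" for j j'
  have A: "(\<Sum>j'<m. A j j' * v j') = apply_mat n (adj L) (apply_mat m L v) j" for v j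
    unfolding A_def apply_mat_def sum_distrib_right sum_distrib_left
    by (subst sum.swap) (simp add: mult_ac)
  have "(\<Sum>j<m. A j j) = of_real (\<Sum>j<m. \<Sum>i<n. (cmod (L i j))\<^sup>2)"
    by (simp add: A_def apply_mat_def adj_def complex_norm_square mult.commute del: of_real_power)
  moreover have "(\<Sum>j<m. \<Sum>i<n. (cmod (L i j))\<^sup>2) > 0"
  proof (rule sum_pos2)
    show "0 < (\<Sum>i<n. (cmod (L i j\<^sub>0))\<^sup>2)"
      using ij by (intro sum_pos2[of _ i\<^sub>0]) (auto simp: L_def)
  qed (use ij in \<open>auto simp: sum_nonneg\<close>)
  ultimately have "(\<Sum>j<m. A j j) \<noteq> 0" by (simp del: of_real_sum of_real_power)
  then obtain \<mu> v where mu: "\<mu> \<noteq> 0" "\<exists>j<m. v j \<noteq> 0"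
    and "\<And>j. j < m \<Longrightarrow> (\<Sum>j'<m. A j j' * v j') = \<mu> * v j"
    by (rule eigenvalue_of_trace[of A m]) blast
  then have ev: "\<And>j. j < m \<Longrightarrow> apply_mat n (adj L) (apply_mat m L v) j = \<mu> * v j"
    by (simp only: A)
  define N where "N = (\<Sum>j<m. (cmod (v j))\<^sup>2)"
  define N' where "N' = (\<Sum>i<n. (cmod (apply_mat m L v i))\<^sup>2)"
  have N: "0 < N"
  proof -
    from mu(2) obtain j where "j < m" "v j \<noteq> 0" by blast
    then show ?thesis unfolding N_def by (intro sum_pos2[of _ j]) auto
  qed
  \<comment> \<open>Pairing the eigenvalue equation with \<open>v\<close> equates \<mu> times the
    squared norm of \<open>v\<close> with the squared norm of L v. So \<mu> is real and nonnegative,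
    and its square root \<open>s\<close> will be the new singular value.\<close>
  have "\<mu> * of_real N = cinner m (\<lambda>j. \<mu> * v j) v"
    by (simp add: cinner_scale_left cinner_self N_def)
  also have "\<dots> = cinner m (apply_mat n (adj L) (apply_mat m L v)) v"
    by (rule cinner_cong) (simp_all add: ev)
  also have "\<dots> = of_real N'"
    by (simp add: cinner_apply_mat cinner_self N'_def)
  finally have mu_N: "\<mu> * of_real N = of_real N'" .
  define r where "r = N' / N"
  have mu_r: "\<mu> = of_real r" using mu_N N by (simp add: r_def field_simps)
  have "r \<ge> 0" using N by (simp add: r_def N'_def sum_nonneg)
  then have r: "r > 0" using mu(1) mu_r by (cases "r = 0") auto
  define s where "s = sqrt r"
  have s: "s > 0" "s * s = r" using r by (auto simp: s_def)
  define h' where "h' = (\<lambda>j. complex_of_real (1 / sqrt N) * v j)"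
  define g' where "g' = (\<lambda>i. complex_of_real (1 / s) * apply_mat m L h' i)"
  have LLh': "apply_mat n (adj L) (apply_mat m L h') j = of_real r * h' j" if "j < m" for j
  proof -
    have "apply_mat n (adj L) (apply_mat m L h') j =
        apply_mat n (adj L) (\<lambda>i. of_real (1 / sqrt N) * apply_mat m L v i) j"
      unfolding h'_def by (intro apply_mat_cong apply_mat_scale)
    then show ?thesis using ev[OF that] by (simp only: apply_mat_scale) (simp add: mu_r h'_def)
  qed
  have h'1: "cinner m h' h' = 1"
  proof -
    have "cinner m h' h' = of_real (1 / sqrt N * (1 / sqrt N) * N)"
      unfolding h'_def cinner_scale_left cinner_scale_right
      by (simp only: cinner_self N_def complex_cnj_complex_of_real of_real_mult mult.assoc)
    also have "1 / sqrt N * (1 / sqrt N) * N = 1" using N by (simp add: field_simps)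
    finally show ?thesis by simp
  qed
  \<comment> \<open>Up to the nonzero factor \<open>r\<close> this is the inner product of L h' with
    L (h l), and the latter vector vanishes.\<close>
  have h'h: "cinner m h' (h l) = 0" if "l < k" for l
  proof -
    have "of_real r * cinner m h' (h l) = cinner m (apply_mat n (adj L) (apply_mat m L h')) (h l)"
      unfolding cinner_scale_left[symmetric] by (rule cinner_cong) (simp_all add: LLh')
    also have "\<dots> = cnj (cinner n (apply_mat m L (h l)) (apply_mat m L h'))"
      by (simp add: cinner_apply_mat cinner_commute[symmetric])
    also have "\<dots> = 0" using Lh[OF that] by (simp add: cinner_zero_left)
    finally show ?thesis using r by simp
  qed
  have g'1: "cinner n g' g' = 1"
  proof -
    have "cinner n (apply_mat m L h') (apply_mat m L h') =
        cnj (cinner m (apply_mat n (adj L) (apply_mat m L h')) h')"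
      by (metis cinner_apply_mat cinner_commute)
    also have "cinner m (apply_mat n (adj L) (apply_mat m L h')) h' = of_real r * cinner m h' h'"
      unfolding cinner_scale_left[symmetric] by (rule cinner_cong) (simp_all add: LLh')
    finally have *: "cinner n (apply_mat m L h') (apply_mat m L h') = of_real r"
      by (simp add: h'1)
    have "cinner n g' g' = of_real (1 / s * (1 / s) * r)"
      unfolding g'_def cinner_scale_left cinner_scale_right *
      by (simp only: complex_cnj_complex_of_real of_real_mult mult.assoc)
    also have "1 / s * (1 / s) * r = 1" using s r by (simp add: field_simps)
    finally show ?thesis by simp
  qed
  have g'g: "cinner n g' (g l) = 0" if "l < k" for l
  proof -
    have "cinner n (apply_mat m L h') (g l) = cnj (cinner m (apply_mat n (adj L) (g l)) h')"
      by (metis cinner_apply_mat cinner_commute)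
    also have "\<dots> = 0" using Lg[OF that] by (simp add: cinner_zero_left)
    finally show ?thesis unfolding g'_def cinner_scale_left by simp
  qed
  \<comment> \<open>The new vectors are orthogonal to the old ones, so \<open>K\<close> and L agree
    on \<open>h'\<close>, and their adjoints agree on \<open>g'\<close>.\<close>
  have Kh': "apply_mat m K h' i = s * g' i" if "i < n" for i
    using L_apply[of h' i] s by (simp add: h'h g'_def)
  have Kg': "apply_mat n (adj K) g' j = s * h' j" if "j < m" for j
  proof -
    have "apply_mat n (adj K) g' j = apply_mat n (adj L) g' j"
      using adjL_apply[of g' j] by (simp add: g'g)
    also have "\<dots> = of_real (1 / s * r) * h' j"
      using LLh'[OF that] unfolding g'_def apply_mat_scale by simp
    also have "1 / s * r = s" using s by (simp add: field_simps)
    finally show ?thesis .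
  qed
  have "singular_system n m K (Suc k) (\<sigma>(k := s)) (g(k := g')) (h(k := h'))"
    using sys s(1) Kh' Kg' orthonormal_extend[of n k g g'] orthonormal_extend[of m k h h']
      g'1 g'g h'1 h'h
    unfolding singular_system_def less_Suc_eq by auto
  then show ?thesis by blast
qed

text \<open>Orthonormality of \<open>g\<close> bounds the length of a singular system by
  \<open>n\<close>. Where a system cannot be extended, the deflated matrix is zero, which is the
  claimed expansion.\<close>

lemma singular_value_decomposition:
  obtains k \<sigma> g h where "singular_system n m K k \<sigma> g h"
    "\<And>i j. i < n \<Longrightarrow> j < m \<Longrightarrow> K i j = (\<Sum>l<k. of_real (\<sigma> l) * g l i * cnj (h l j))"
proof -
  define Q where "Q k \<longleftrightarrow> (\<exists>\<sigma> g h. singular_system n m K k \<sigma> g h)" for k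
  have "Q 0" by (simp add: Q_def singular_system_def orthonormal_def)
  moreover have bound: "k \<le> n" if "Q k" for k
    using that by (auto simp: Q_def singular_system_def intro: orthonormal_card_le)
  \<comment> \<open>If \<open>Q k\<close> always implied \<open>Q (Suc k)\<close>, induction would
    give \<open>Q\<close> for all numbers, against the bound.\<close>
  ultimately obtain k where "Q k" and max: "\<not> Q (Suc k)"
    by (metis Suc_n_not_le_n nat_induct)
  then obtain \<sigma> g h where sys: "singular_system n m K k \<sigma> g h" by (auto simp: Q_def)
  show thesis
    by (rule that[OF sys]) (use singular_system_extend[OF sys] max in \<open>auto simp: Q_def\<close>)
qed

section \<open>Positive semidefinite matrices\<close>

definition psd :: "nat \<Rightarrow> (nat \<Rightarrow> nat \<Rightarrow> complex) \<Rightarrow> bool" where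
  "psd r f \<longleftrightarrow> (\<forall>i<r. \<forall>j<r. f j i = cnj (f i j)) \<and> (\<forall>v. 0 \<le> Re (cinner r (apply_mat r f v) v))"

lemma psdI:
  assumes "\<And>i j. i < r \<Longrightarrow> j < r \<Longrightarrow> f j i = cnj (f i j)"
    and "\<And>v. 0 \<le> Re (cinner r (apply_mat r f v) v)"
  shows "psd r f"
  unfolding psd_def using assms by blast

lemma psd_hermitian: "psd r f \<Longrightarrow> i < r \<Longrightarrow> j < r \<Longrightarrow> f j i = cnj (f i j)"
  unfolding psd_def by blast

lemma psd_nonneg: "psd r f \<Longrightarrow> 0 \<le> Re (cinner r (apply_mat r f v) v)"
  unfolding psd_def by blast

lemma psd_apply_adj: "psd r f \<Longrightarrow> i < r \<Longrightarrow> apply_mat r (adj f) v i = apply_mat r f v i"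
  unfolding apply_mat_def adj_def by (intro sum.cong refl) (metis lessThan_iff psd_hermitian)

text \<open>For a singular pair of a positive semidefinite matrix, the difference of the left and the right
  vector is an eigenvector with a negative eigenvalue, hence zero.\<close>

lemma psd_decomposition:
  assumes f: "psd r f"
  obtains k :: nat and \<tau> :: "nat \<Rightarrow> real" and u where "\<And>l. l < k \<Longrightarrow> 0 < \<tau> l"
    "\<And>i j. i < r \<Longrightarrow> j < r \<Longrightarrow> f i j = (\<Sum>l<k. of_real (\<tau> l) * u l i * cnj (u l j))"
proof -
  obtain k \<sigma> g h where sys: "singular_system r r f k \<sigma> g h"
    and dec: "\<And>i j. i < r \<Longrightarrow> j < r \<Longrightarrow> f i j = (\<Sum>l<k. of_real (\<sigma> l) * g l i * cnj (h l j))"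
    by (rule singular_value_decomposition[of r r f]) blast
  have eq: "g l i = h l i" if "l < k" "i < r" for l i
  proof -
    define w where "w = (\<lambda>i. g l i - h l i)"
    have fg: "apply_mat r f (g l) i = \<sigma> l * h l i" and fh: "apply_mat r f (h l) i = \<sigma> l * g l i"
      if "i < r" for i
      using sys \<open>l < k\<close> that psd_apply_adj[OF f that, of "g l"] by (auto simp: singular_system_def)
    have "apply_mat r f w i = - of_real (\<sigma> l) * w i" if "i < r" for i
    proof -
      have "apply_mat r f w i = apply_mat r f (g l) i - apply_mat r f (h l) i"
        by (simp add: w_def apply_mat_def right_diff_distrib sum_subtractf)
      then show ?thesis using that by (simp add: fg fh w_def algebra_simps)
    qed
    then have "cinner r (apply_mat r f w) w = - of_real (\<sigma> l) * cinner r w w"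
      unfolding cinner_scale_left[symmetric] by (intro cinner_cong) auto
    moreover have "0 \<le> Re (cinner r (apply_mat r f w) w)" using f by (rule psd_nonneg)
    ultimately have "\<sigma> l * (\<Sum>i<r. (cmod (w i))\<^sup>2) \<le> 0" by (simp add: cinner_self)
    moreover have "0 < \<sigma> l" using sys that by (simp add: singular_system_def)
    ultimately have "(\<Sum>i<r. (cmod (w i))\<^sup>2) \<le> 0" by (simp add: mult_le_0_iff)
    then have "(\<Sum>i<r. (cmod (w i))\<^sup>2) = 0" by (intro antisym sum_nonneg) auto
    then have "cinner r w w = 0" by (simp only: cinner_self of_real_0)
    from cinner_self_eq_0[OF this \<open>i < r\<close>] show ?thesis by (simp add: w_def)
  qed
  show thesis
  proof (rule that[of k \<sigma> h])
    show "0 < \<sigma> l" if "l < k" for l using sys that by (simp add: singular_system_def)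
    show "f i j = (\<Sum>l<k. of_real (\<sigma> l) * h l i * cnj (h l j))" if "i < r" "j < r" for i j
      using dec[OF that] eq that by simp
  qed
qed

text \<open>Expanding \<open>g\<close> into positive multiples of the rank-one matrices
  \<open>u l i * cnj (u l j)\<close> turns the sum into a positive combination of values of the
  quadratic form of \<open>f\<close>. This is the source of entrywise nonnegativity of the Gram
  matrix.\<close>

lemma psd_frobenius_nonneg:
  assumes f: "psd r f" and g: "psd r g"
  shows "0 \<le> Re (\<Sum>i<r. \<Sum>j<r. f i j * cnj (g i j))"
proof -
  obtain k :: nat and \<tau> :: "nat \<Rightarrow> real" and u where t: "\<And>l. l < k \<Longrightarrow> 0 < \<tau> l"
    and dec: "\<And>i j. i < r \<Longrightarrow> j < r \<Longrightarrow> g i j = (\<Sum>l<k. of_real (\<tau> l) * u l i * cnj (u l j))"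
    by (rule psd_decomposition[OF g]) blast
  have "(\<Sum>i<r. \<Sum>j<r. f i j * cnj (g i j)) =
      (\<Sum>i<r. \<Sum>j<r. \<Sum>l<k. of_real (\<tau> l) * (f i j * u l j * cnj (u l i)))"
    by (simp add: dec sum_distrib_left mult_ac)
  also have "\<dots> = (\<Sum>i<r. \<Sum>l<k. \<Sum>j<r. of_real (\<tau> l) * (f i j * u l j * cnj (u l i)))"
    by (rule sum.cong[OF refl], rule sum.swap)
  also have "\<dots> = (\<Sum>l<k. \<Sum>i<r. \<Sum>j<r. of_real (\<tau> l) * (f i j * u l j * cnj (u l i)))"
    by (rule sum.swap)
  also have "\<dots> = (\<Sum>l<k. of_real (\<tau> l) * cinner r (apply_mat r f (u l)) (u l))"
    by (simp add: cinner_def apply_mat_def sum_distrib_left sum_distrib_right)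
  also have "Re \<dots> = (\<Sum>l<k. \<tau> l * Re (cinner r (apply_mat r f (u l)) (u l)))"
    by simp
  also have "\<dots> \<ge> 0"
    using t f by (intro sum_nonneg mult_nonneg_nonneg) (auto simp: less_imp_le psd_nonneg)
  finally show ?thesis .
qed

text \<open>The form of the conjugated matrix at \<open>v\<close> is the conjugate of the original
  form at the conjugate of \<open>v\<close>.\<close>

lemma psd_cnj:
  assumes "psd r f"
  shows "psd r (\<lambda>i j. cnj (f i j))"
proof -
  have "cinner r (apply_mat r (\<lambda>i j. cnj (f i j)) v) v =
      cnj (cinner r (apply_mat r f (\<lambda>i. cnj (v i))) (\<lambda>i. cnj (v i)))" for v
    by (simp add: cinner_def apply_mat_def)
  then have "0 \<le> Re (cinner r (apply_mat r (\<lambda>i j. cnj (f i j)) v) v)" for v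
    using psd_nonneg[OF assms] by simp
  moreover have "cnj (f j i) = cnj (cnj (f i j))" if "i < r" "j < r" for i j
    using psd_hermitian[OF assms that] by simp
  ultimately show ?thesis by (intro psdI)
qed

section \<open>Compression of operators to an orthonormal system\<close>

text \<open>This is D G* X G D, where G has the columns \<open>g l\<close> and D is the diagonal
  matrix of \<open>c\<close>. It is used with \<open>c\<close> the square roots of the Schmidt
  coefficients.\<close>

definition compression ::
  "nat \<Rightarrow> (nat \<Rightarrow> real) \<Rightarrow> (nat \<Rightarrow> nat \<Rightarrow> complex) \<Rightarrow> (nat \<Rightarrow> nat \<Rightarrow> complex) \<Rightarrow> nat \<Rightarrow> nat \<Rightarrow> complex" where
  "compression n c g X l l' = of_real (c l * c l') * cinner n (apply_mat n X (g l')) (g l)"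

text \<open>The quadratic form of D G* X G D at \<open>v\<close> is the form of \<open>X\<close> at
  the vector \<open>w\<close> = G D v.\<close>

lemma psd_compression:
  assumes X: "psd n X"
  shows "psd r (compression n c g X)"
proof -
  have herm: "compression n c g X l' l = cnj (compression n c g X l l')" for l l'
  proof -
    have "cinner n (apply_mat n X (g l)) (g l') = cinner n (g l) (apply_mat n (adj X) (g l'))"
      by (rule cinner_apply_mat)
    also have "\<dots> = cinner n (g l) (apply_mat n X (g l'))"
      by (rule cinner_cong) (simp_all add: psd_apply_adj[OF X])
    also have "\<dots> = cnj (cinner n (apply_mat n X (g l')) (g l))" by (rule cinner_commute)
    finally show ?thesis by (simp add: compression_def)
  qed
  have "0 \<le> Re (cinner r (apply_mat r (compression n c g X) v) v)" for v
  proof -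
    define w where "w i = (\<Sum>l<r. of_real (c l) * v l * g l i)" for i
    have Xw: "apply_mat n X w i = (\<Sum>l<r. of_real (c l) * v l * apply_mat n X (g l) i)" for i
      unfolding apply_mat_def w_def sum_distrib_left by (subst sum.swap) (simp add: mult_ac)
    have "cinner n (apply_mat n X w) w =
        (\<Sum>i<n. \<Sum>l'<r. \<Sum>l<r. of_real (c l') * v l' * apply_mat n X (g l') i *
                              (of_real (c l) * cnj (v l) * cnj (g l i)))"
      by (simp add: cinner_def Xw w_def sum_product)
    also have "\<dots> = (\<Sum>i<n. \<Sum>l<r. \<Sum>l'<r. of_real (c l') * v l' * apply_mat n X (g l') i *
                              (of_real (c l) * cnj (v l) * cnj (g l i)))"
      by (rule sum.cong[OF refl], rule sum.swap)
    also have "\<dots> = (\<Sum>l<r. \<Sum>i<n. \<Sum>l'<r. of_real (c l') * v l' * apply_mat n X (g l') i *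
                              (of_real (c l) * cnj (v l) * cnj (g l i)))"
      by (rule sum.swap)
    also have "\<dots> = (\<Sum>l<r. \<Sum>l'<r. \<Sum>i<n. of_real (c l') * v l' * apply_mat n X (g l') i *
                              (of_real (c l) * cnj (v l) * cnj (g l i)))"
      by (rule sum.cong[OF refl], rule sum.swap)
    also have "\<dots> = (\<Sum>l<r. \<Sum>l'<r. compression n c g X l l' * v l' * cnj (v l))"
      by (intro sum.cong refl)
        (simp add: compression_def cinner_def sum_distrib_left sum_distrib_right mult_ac)
    also have "\<dots> = cinner r (apply_mat r (compression n c g X) v) v"
      by (simp add: cinner_def apply_mat_def sum_distrib_right)
    finally show ?thesis using psd_nonneg[OF X, of w] by simp
  qed
  with herm show ?thesis by (intro psdI)
qed

text \<open>Compression is linear in the operator, so the sum is D G* G D, which orthonormality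
  reduces to the square of D.\<close>

lemma sum_compression:
  fixes X :: "'o::finite \<Rightarrow> nat \<Rightarrow> nat \<Rightarrow> complex"
  assumes one: "\<And>i j. i < n \<Longrightarrow> j < n \<Longrightarrow> (\<Sum>a\<in>UNIV. X a i j) = of_bool (i = j)"
    and g: "orthonormal n k g" and l: "l < k" "l' < k"
  shows "(\<Sum>a\<in>UNIV. compression n c g (X a) l l') = of_bool (l = l') * of_real ((c l)\<^sup>2)"
proof -
  have "(\<Sum>a\<in>UNIV. compression n c g (X a) l l') =
      of_real (c l * c l') * (\<Sum>a\<in>UNIV. \<Sum>i<n. apply_mat n (X a) (g l') i * cnj (g l i))"
    by (simp add: compression_def cinner_def sum_distrib_left)
  also have "(\<Sum>a\<in>UNIV. \<Sum>i<n. apply_mat n (X a) (g l') i * cnj (g l i)) = cinner n (g l') (g l)"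
  proof -
    have "(\<Sum>a\<in>UNIV. apply_mat n (X a) (g l') i) = g l' i" if "i < n" for i
    proof -
      have "(\<Sum>a\<in>UNIV. apply_mat n (X a) (g l') i) = (\<Sum>j<n. (\<Sum>a\<in>UNIV. X a i j) * g l' j)"
        unfolding apply_mat_def sum_distrib_right by (rule sum.swap)
      also have "\<dots> = (\<Sum>j<n. if i = j then g l' j else 0)"
        using that by (intro sum.cong) (auto simp: one)
      finally show ?thesis using that by simp
    qed
    then show ?thesis
      by (subst sum.swap) (simp add: cinner_def sum_distrib_right[symmetric])
  qed
  finally show ?thesis using g l by (auto simp: orthonormal_def power2_eq_square)
qed

section \<open>The state as a coefficient matrix\<close>

lemma sum_product_separated:
  fixes \<alpha> \<beta> :: "nat \<Rightarrow> 'a::comm_semiring_0"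
  shows "(\<Sum>i<n. \<Sum>j<m. \<alpha> i * \<beta> j * (\<Sum>l<k. \<gamma> l i * \<delta> l j)) =
    (\<Sum>l<k. (\<Sum>i<n. \<alpha> i * \<gamma> l i) * (\<Sum>j<m. \<beta> j * \<delta> l j))"
proof -
  have "(\<Sum>i<n. \<Sum>j<m. \<alpha> i * \<beta> j * (\<Sum>l<k. \<gamma> l i * \<delta> l j)) =
      (\<Sum>i<n. \<Sum>j<m. \<Sum>l<k. \<alpha> i * \<gamma> l i * (\<beta> j * \<delta> l j))"
    by (simp add: sum_distrib_left mult_ac)
  also have "\<dots> = (\<Sum>i<n. \<Sum>l<k. \<Sum>j<m. \<alpha> i * \<gamma> l i * (\<beta> j * \<delta> l j))"
    by (rule sum.cong[OF refl], rule sum.swap)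
  also have "\<dots> = (\<Sum>l<k. \<Sum>i<n. \<Sum>j<m. \<alpha> i * \<gamma> l i * (\<beta> j * \<delta> l j))"
    by (rule sum.swap)
  finally show ?thesis by (simp add: sum_product)
qed

text \<open>Pairing two finite-rank expansions entry by entry leaves one sum per tensor factor; with
  singular vectors inserted, these become inner products.\<close>

lemma sum_product_separated2:
  fixes \<alpha> \<beta> :: "nat \<Rightarrow> nat \<Rightarrow> 'a::comm_semiring_0"
  shows "(\<Sum>i<n. \<Sum>j<m. (\<Sum>l<k. \<alpha> l i * \<beta> l j) * (\<Sum>l<k'. \<gamma> l i * \<delta> l j)) =
    (\<Sum>l<k. \<Sum>l'<k'. (\<Sum>i<n. \<alpha> l i * \<gamma> l' i) * (\<Sum>j<m. \<beta> l j * \<delta> l' j))"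
proof -
  have "(\<Sum>i<n. \<Sum>j<m. (\<Sum>l<k. \<alpha> l i * \<beta> l j) * (\<Sum>l<k'. \<gamma> l i * \<delta> l j)) =
      (\<Sum>i<n. \<Sum>j<m. \<Sum>l<k. \<alpha> l i * \<beta> l j * (\<Sum>l<k'. \<gamma> l i * \<delta> l j))"
    by (simp only: sum_distrib_right)
  also have "\<dots> = (\<Sum>i<n. \<Sum>l<k. \<Sum>j<m. \<alpha> l i * \<beta> l j * (\<Sum>l<k'. \<gamma> l i * \<delta> l j))"
    by (rule sum.cong[OF refl], rule sum.swap)
  also have "\<dots> = (\<Sum>l<k. \<Sum>i<n. \<Sum>j<m. \<alpha> l i * \<beta> l j * (\<Sum>l<k'. \<gamma> l i * \<delta> l j))"
    by (rule sum.swap)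
  finally show ?thesis by (simp only: sum_product_separated)
qed

lemma sum_scaled_cnj:
  "(\<Sum>i<n. of_real a * u i * (of_real b * cnj (v i))) = of_real (a * b) * cinner n u v"
  by (simp add: cinner_def sum_distrib_left mult_ac)

lemma sum_cnj_mult: "(\<Sum>i<n. cnj (u i) * v i) = cinner n v u"
  by (simp add: cinner_def mult.commute)

text \<open>The squared Frobenius norm of \<open>K\<close> expands into inner products of singular
  vectors, and orthonormality leaves only the diagonal terms. For a unit state the squared Schmidt
  coefficients thus sum to 1.\<close>

lemma sum_singular_values_sq:
  assumes sys: "singular_system n m K k \<sigma> g h"
    and K: "\<And>i j. i < n \<Longrightarrow> j < m \<Longrightarrow> K i j = (\<Sum>l<k. of_real (\<sigma> l) * g l i * cnj (h l j))"
  shows "(\<Sum>i<n. \<Sum>j<m. K i j * cnj (K i j)) = of_real (\<Sum>l<k. (\<sigma> l)\<^sup>2)"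
proof -
  have "(\<Sum>i<n. \<Sum>j<m. K i j * cnj (K i j)) =
      (\<Sum>i<n. \<Sum>j<m. (\<Sum>l<k. (of_real (\<sigma> l) * g l i) * cnj (h l j)) *
                    (\<Sum>l<k. (of_real (\<sigma> l) * cnj (g l i)) * h l j))"
    by (simp add: K)
  also have "\<dots> = (\<Sum>l<k. \<Sum>l'<k. of_real (\<sigma> l * \<sigma> l') * cinner n (g l) (g l') * cinner m (h l') (h l))"
    by (simp only: sum_product_separated2 sum_scaled_cnj sum_cnj_mult)
  also have "\<dots> = (\<Sum>l<k. \<Sum>l'<k. if l' = l then of_real ((\<sigma> l)\<^sup>2) else 0)"
    using sys by (intro sum.cong refl) (auto simp: singular_system_def orthonormal_def power2_eq_square)
  finally show ?thesis by simp
qed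

text \<open>As a matrix, the state is \<open>K = G \<Sigma> H\<^sup>*\<close>; the square root of \<open>\<Sigma>\<close> is shared between the two
  compressed operators, which turns \<open>tr (X K Y\<^sup>T K\<^sup>*)\<close> into a Frobenius inner product.\<close>

lemma bilinear_form_compression:
  assumes pos: "\<And>l. l < k \<Longrightarrow> 0 \<le> \<sigma> l"
    and K: "\<And>i j. i < n \<Longrightarrow> j < m \<Longrightarrow> K i j = (\<Sum>l<k. of_real (\<sigma> l) * g l i * cnj (h l j))"
  shows "(\<Sum>i<n. \<Sum>j<m. (\<Sum>i'<n. \<Sum>j'<m. X i i' * Y j j' * K i' j') * cnj (K i j)) =
    (\<Sum>l<k. \<Sum>l'<k. compression n (\<lambda>l. sqrt (\<sigma> l)) g X l l' *
                    cnj (compression m (\<lambda>l. sqrt (\<sigma> l)) h (\<lambda>i j. cnj (Y i j)) l l'))"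
proof -
  let ?Y = "\<lambda>i j. cnj (Y i j)"
  have 1: "(\<Sum>i'<n. \<Sum>j'<m. X i i' * Y j j' * K i' j') =
      (\<Sum>l'<k. (of_real (\<sigma> l') * apply_mat n X (g l') i) * cnj (apply_mat m ?Y (h l') j))" for i j
  proof -
    have "(\<Sum>i'<n. \<Sum>j'<m. X i i' * Y j j' * K i' j') =
        (\<Sum>i'<n. \<Sum>j'<m. X i i' * Y j j' * (\<Sum>l'<k. (of_real (\<sigma> l') * g l' i') * cnj (h l' j')))"
      by (simp add: K)
    then show ?thesis
      unfolding sum_product_separated by (simp add: apply_mat_def sum_distrib_left mult_ac)
  qed
  have "(\<Sum>i<n. \<Sum>j<m. (\<Sum>i'<n. \<Sum>j'<m. X i i' * Y j j' * K i' j') * cnj (K i j)) =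
      (\<Sum>i<n. \<Sum>j<m. (\<Sum>l'<k. (of_real (\<sigma> l') * apply_mat n X (g l') i) * cnj (apply_mat m ?Y (h l') j)) *
                    (\<Sum>l<k. (of_real (\<sigma> l) * cnj (g l i)) * h l j))"
    unfolding 1 by (simp add: K)
  also have "\<dots> = (\<Sum>l'<k. \<Sum>l<k. of_real (\<sigma> l' * \<sigma> l) * cinner n (apply_mat n X (g l')) (g l) *
                                  cinner m (h l) (apply_mat m ?Y (h l')))"
    by (simp only: sum_product_separated2 sum_scaled_cnj sum_cnj_mult)
  also have "\<dots> = (\<Sum>l<k. \<Sum>l'<k. of_real (\<sigma> l' * \<sigma> l) * cinner n (apply_mat n X (g l')) (g l) *
                                  cinner m (h l) (apply_mat m ?Y (h l')))"
    by (rule sum.swap)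
  also have "\<dots> = (\<Sum>l<k. \<Sum>l'<k. compression n (\<lambda>l. sqrt (\<sigma> l)) g X l l' *
                    cnj (compression m (\<lambda>l. sqrt (\<sigma> l)) h ?Y l l'))"
  proof (intro sum.cong refl)
    fix l l' assume "l \<in> {..<k}" "l' \<in> {..<k}"
    \<comment> \<open>Nonnegativity allows each coefficient to be written as a product of two square
      roots; each of the two compressions receives one equal factor.\<close>
    then have s: "complex_of_real (\<sigma> l' * \<sigma> l) =
        of_real (sqrt (\<sigma> l) * sqrt (\<sigma> l')) * of_real (sqrt (\<sigma> l) * sqrt (\<sigma> l'))"
      using pos unfolding of_real_mult[symmetric] by (simp add: algebra_simps)
    show "of_real (\<sigma> l' * \<sigma> l) * cinner n (apply_mat n X (g l')) (g l) *
          cinner m (h l) (apply_mat m ?Y (h l')) =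
        compression n (\<lambda>l. sqrt (\<sigma> l)) g X l l' * cnj (compression m (\<lambda>l. sqrt (\<sigma> l)) h ?Y l l')"
      unfolding s compression_def cinner_commute[of m "h l"] by (simp add: mult_ac)
  qed
  finally show ?thesis .
qed

section \<open>Tensor products and measurements in coordinates\<close>

lemma sum_div_mod:
  fixes F :: "nat \<Rightarrow> 'a::comm_monoid_add"
  shows "(\<Sum>q<n * m. F q) = (\<Sum>i<n. \<Sum>j<m. F (i * m + j))"
proof -
  have "(\<Sum>q<n * m. F q) = (\<Sum>i<n. \<Sum>q\<in>{i * m..<i * m + m}. F q)"
    by (rule sum.nat_group[symmetric])
  also have "\<dots> = (\<Sum>i<n. \<Sum>j<m. F (i * m + j))"
  proof (rule sum.cong[OF refl])
    show "(\<Sum>q\<in>{i * m..<i * m + m}. F q) = (\<Sum>j<m. F (i * m + j))" for i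
      using sum.shift_bounds_nat_ivl[of F 0 "i * m" m] by (simp add: atLeast0LessThan add.commute)
  qed
  finally show ?thesis .
qed

text \<open>Splitting both the row and the column index as \<open>i * m + j\<close> matches the
  ordering of the Kronecker product and presents the state as an n by m matrix.\<close>

lemma kronecker_form:
  assumes X: "X \<in> carrier_mat n n" and Y: "Y \<in> carrier_mat m m" and \<psi>: "\<psi> \<in> carrier_vec (n * m)"
  shows "((X \<otimes>\<^sub>K Y) *\<^sub>v \<psi>) \<bullet>c \<psi> =
    (\<Sum>i<n. \<Sum>j<m. (\<Sum>i'<n. \<Sum>j'<m. X $$ (i, i') * Y $$ (j, j') * vec_index \<psi> (i' * m + j')) *
                  cnj (vec_index \<psi> (i * m + j)))"
proof -
  have d: "dim_row X = n" "dim_col X = n" "dim_row Y = m" "dim_col Y = m" "dim_vec \<psi> = n * m"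
    using assms by auto
  have "((X \<otimes>\<^sub>K Y) *\<^sub>v \<psi>) \<bullet>c \<psi> =
      (\<Sum>q<n * m. (\<Sum>q'<n * m. X $$ (q div m, q' div m) * Y $$ (q mod m, q' mod m) * vec_index \<psi> q') *
                  cnj (vec_index \<psi> q))"
    by (simp add: kronecker_mat_def scalar_prod_def d atLeast0LessThan)
  then show ?thesis by (simp add: sum_div_mod)
qed

lemma norm_form:
  assumes "\<psi> \<in> carrier_vec (n * m)"
  shows "\<psi> \<bullet>c \<psi> = (\<Sum>i<n. \<Sum>j<m. vec_index \<psi> (i * m + j) * cnj (vec_index \<psi> (i * m + j)))"
proof -
  have "\<psi> \<bullet>c \<psi> = (\<Sum>q<n * m. vec_index \<psi> q * cnj (vec_index \<psi> q))"
    using assms by (simp add: scalar_prod_def atLeast0LessThan)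
  then show ?thesis by (simp add: sum_div_mod)
qed

lemma psd_of_hermitian_psd:
  assumes "hermitian_psd n A"
  shows "psd n (\<lambda>i j. A $$ (i, j))"
proof -
  have A: "A \<in> carrier_mat n n" and adj: "mat_adjoint A = A"
    and pos: "\<And>v. v \<in> carrier_vec n \<Longrightarrow> 0 \<le> Re ((A *\<^sub>v v) \<bullet>c v)"
    using assms by (auto simp: hermitian_psd_def)
  have "A $$ (j, i) = cnj (A $$ (i, j))" if "i < n" "j < n" for i j
  proof -
    have "mat_adjoint A $$ (j, i) = cnj (A $$ (i, j))"
      using A that by (simp add: mat_adjoint_def mat_of_rows_index)
    then show ?thesis by (simp add: adj)
  qed
  moreover have "0 \<le> Re (cinner n (apply_mat n (\<lambda>i j. A $$ (i, j)) v) v)" for v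
  proof -
    have "cinner n (apply_mat n (\<lambda>i j. A $$ (i, j)) v) v = (A *\<^sub>v Matrix.vec n v) \<bullet>c Matrix.vec n v"
      using A by (simp add: cinner_def apply_mat_def scalar_prod_def atLeast0LessThan)
    then show ?thesis using pos[of "Matrix.vec n v"] by simp
  qed
  ultimately show ?thesis by (intro psdI)
qed

lemma measurement_sum:
  assumes "measurement n M" "i < n" "j < n"
  shows "(\<Sum>a\<in>UNIV. M a $$ (i, j)) = of_bool (i = j)"
proof -
  have "Matrix.mat n n (\<lambda>ij. \<Sum>a\<in>UNIV. M a $$ ij) $$ (i, j) = 1\<^sub>m n $$ (i, j)"
    using assms(1) by (simp add: measurement_def)
  then show ?thesis using assms(2,3) by simp
qed

lemma sum_swap_pairs:
  "(\<Sum>a\<in>A. \<Sum>b\<in>B. \<Sum>c\<in>C. \<Sum>d\<in>D. F a b c d) = (\<Sum>c\<in>C. \<Sum>d\<in>D. \<Sum>a\<in>A. \<Sum>b\<in>B. F a b c d)"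
proof -
  have "(\<Sum>a\<in>A. \<Sum>b\<in>B. \<Sum>c\<in>C. \<Sum>d\<in>D. F a b c d) = (\<Sum>a\<in>A. \<Sum>c\<in>C. \<Sum>b\<in>B. \<Sum>d\<in>D. F a b c d)"
    by (rule sum.cong[OF refl], rule sum.swap)
  also have "\<dots> = (\<Sum>c\<in>C. \<Sum>a\<in>A. \<Sum>b\<in>B. \<Sum>d\<in>D. F a b c d)"
    by (rule sum.swap)
  also have "\<dots> = (\<Sum>c\<in>C. \<Sum>a\<in>A. \<Sum>d\<in>D. \<Sum>b\<in>B. F a b c d)"
    by (rule sum.cong[OF refl], rule sum.cong[OF refl], rule sum.swap)
  also have "\<dots> = (\<Sum>c\<in>C. \<Sum>d\<in>D. \<Sum>a\<in>A. \<Sum>b\<in>B. F a b c d)"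
    by (rule sum.cong[OF refl], rule sum.swap)
  finally show ?thesis .
qed

text \<open>Bilinearity over the reals of the real part of the Frobenius inner product. Weights 1 on
  blocks give the block sums; equal weights on all indices give positivity of the Gram
  matrix.\<close>

lemma gram_bilinear:
  fixes x :: "'u \<Rightarrow> real" and y :: "'v \<Rightarrow> real"
  shows "(\<Sum>u\<in>A. \<Sum>v\<in>B. x u * y v * Re (\<Sum>l<k. \<Sum>l'<k. Z u l l' * cnj (Z' v l l'))) =
    Re (\<Sum>l<k. \<Sum>l'<k. (\<Sum>u\<in>A. of_real (x u) * Z u l l') * cnj (\<Sum>v\<in>B. of_real (y v) * Z' v l l'))"
proof -
  have "(\<Sum>l<k. \<Sum>l'<k. (\<Sum>u\<in>A. of_real (x u) * Z u l l') * cnj (\<Sum>v\<in>B. of_real (y v) * Z' v l l')) =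
      (\<Sum>l<k. \<Sum>l'<k. \<Sum>u\<in>A. \<Sum>v\<in>B. of_real (x u * y v) * (Z u l l' * cnj (Z' v l l')))"
    unfolding cnj_sum sum_product by (simp add: mult_ac)
  also have "\<dots> = (\<Sum>u\<in>A. \<Sum>v\<in>B. \<Sum>l<k. \<Sum>l'<k. of_real (x u * y v) * (Z u l l' * cnj (Z' v l l')))"
    by (rule sum_swap_pairs)
  also have "\<dots> = (\<Sum>u\<in>A. \<Sum>v\<in>B. of_real (x u * y v) * (\<Sum>l<k. \<Sum>l'<k. Z u l l' * cnj (Z' v l l')))"
    by (simp only: sum_distrib_left)
  finally show ?thesis by simp
qed

section \<open>The two inclusions\<close>

lemma block_image:
  "block (Inl s) = Inl ` Pair s ` UNIV" "block (Inr t) = Inr ` Pair t ` UNIV"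
  by auto

lemma sum_block:
  "(\<Sum>u\<in>block (Inl s). f u) = (\<Sum>a\<in>UNIV. f (Inl (s, a)))"
  "(\<Sum>u\<in>block (Inr t). f u) = (\<Sum>b\<in>UNIV. f (Inr (t, b)))"
  by (simp_all only: block_image, simp_all add: sum.reindex inj_on_def)

lemma quantum_subset_Corr:
  "(quantum_correlations :: ('a::finite, 'b::finite, 's::finite, 't::finite) correlation set)
     \<subseteq> Corr doubly_nonnegative"
proof
  fix p :: "('a, 'b, 's, 't) correlation"
  assume "p \<in> quantum_correlations"
  then obtain n m \<psi> X Y where p: "p \<in> prob_correlations"
    and \<psi>: "\<psi> \<in> carrier_vec (n * m)" "\<psi> \<bullet>c \<psi> = 1"
    and X: "\<And>s. measurement n (X s)" and Y: "\<And>t. measurement m (Y t)"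
    and pXY: "\<And>a b s t. complex_of_real (p a b s t) = ((X s a \<otimes>\<^sub>K Y t b) *\<^sub>v \<psi>) \<bullet>c \<psi>"
    unfolding quantum_correlations_def by blast
  have Xpsd: "hermitian_psd n (X s a)" and Ypsd: "hermitian_psd m (Y t b)" for s a t b
    using X Y by (auto simp: measurement_def)
  \<comment> \<open>The state is reshaped into an n by m matrix, whose singular value decomposition
    is a Schmidt decomposition of the state.\<close>
  define K where "K i j = vec_index \<psi> (i * m + j)" for i j
  obtain k \<sigma> g h where sys: "singular_system n m K k \<sigma> g h"
    and K: "\<And>i j. i < n \<Longrightarrow> j < m \<Longrightarrow> K i j = (\<Sum>l<k. of_real (\<sigma> l) * g l i * cnj (h l j))"
    by (rule singular_value_decomposition[of n m K]) blast
  have pos: "0 \<le> \<sigma> l" if "l < k" for l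
    using sys that by (auto simp: singular_system_def less_imp_le)
  have sq: "(\<Sum>l<k. (\<sigma> l)\<^sup>2) = 1"
  proof -
    have "complex_of_real (\<Sum>l<k. (\<sigma> l)\<^sup>2) = \<psi> \<bullet>c \<psi>"
      unfolding norm_form[OF \<psi>(1)] K_def[symmetric]
      by (rule sum_singular_values_sq[OF sys K, symmetric])
    then show ?thesis using \<psi>(2) by (metis of_real_eq_1_iff)
  qed
  define c where "c = (\<lambda>l. sqrt (\<sigma> l))"
  define x where "x s a = compression n c g (\<lambda>i j. X s a $$ (i, j))" for s a
  \<comment> \<open>The Schmidt vectors of the second factor are the conjugates of
    \<open>h l\<close>. Conjugating \<open>Y\<close> and keeping \<open>h\<close> gives the
    conjugates of the weighted matrix elements of \<open>Y\<close> in these vectors.\<close>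
  define y where "y t b = compression m c h (\<lambda>i j. cnj (Y t b $$ (i, j)))" for t b
  define Z :: "('a, 'b, 's, 't) block_index \<Rightarrow> nat \<Rightarrow> nat \<Rightarrow> complex" where
    "Z = case_sum (case_prod x) (case_prod y)"
  have Zpsd: "psd k (Z u)" for u
    by (auto simp: Z_def x_def y_def split: sum.split
        intro!: psd_compression psd_cnj psd_of_hermitian_psd Xpsd Ypsd)
  define G where "G u v = Re (\<Sum>l<k. \<Sum>l'<k. Z u l l' * cnj (Z v l l'))" for u v
  define M :: "real ^ ('a, 'b, 's, 't) block_index ^ ('a, 'b, 's, 't) block_index"
    where "M = (\<chi> u v. G u v)"
  have M: "vec_nth (vec_nth M u) v = G u v" for u v by (simp add: M_def)
  have Zsum: "(\<Sum>u\<in>block i. Z u l l') = of_bool (l = l') * of_real (\<sigma> l)"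
    if "l < k" "l' < k" for i l l'
  proof (cases i)
    case (Inl s)
    have "(\<Sum>a\<in>UNIV. x s a l l') = of_bool (l = l') * of_real ((c l)\<^sup>2)"
      unfolding x_def
      by (rule sum_compression) (use sys that in \<open>auto simp: measurement_sum[OF X] singular_system_def\<close>)
    then show ?thesis using pos that by (simp add: Inl sum_block Z_def c_def del: block.simps)
  next
    case (Inr t)
    \<comment> \<open>The identity matrix is real, so the conjugated operators still sum to
      it.\<close>
    have "(\<Sum>b\<in>UNIV. y t b l l') = of_bool (l = l') * of_real ((c l)\<^sup>2)"
      unfolding y_def
      by (rule sum_compression)
        (use sys that in \<open>auto simp: cnj_sum[symmetric] measurement_sum[OF Y] singular_system_def simp del: cnj_sum\<close>)
    then show ?thesis using pos that by (simp add: Inr sum_block Z_def c_def del: block.simps)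
  qed
  have "block_sum i j M = 1" for i j
  proof -
    have "block_sum i j M = Re (\<Sum>l<k. \<Sum>l'<k. (\<Sum>u\<in>block i. Z u l l') * cnj (\<Sum>v\<in>block j. Z v l l'))"
      using gram_bilinear[where x = "\<lambda>_. 1" and y = "\<lambda>_. 1" and k = k and Z = Z and Z' = Z
          and A = "block i" and B = "block j"]
      by (simp add: block_sum_def M G_def)
    \<comment> \<open>Both blocks sum to the same diagonal matrix of \<sigma>, whichever parties
      they belong to, so only its squared Frobenius norm remains.\<close>
    also have "\<dots> = Re (\<Sum>l<k. \<Sum>l'<k. if l' = l then of_real ((\<sigma> l)\<^sup>2) else 0)"
      by (intro arg_cong[where f = Re] sum.cong refl) (auto simp: Zsum power2_eq_square)
    also have "\<dots> = 1" using sq by simp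
    finally show ?thesis .
  qed
  moreover have "vec_nth (vec_nth M (Inl (s, a))) (Inr (t, b)) = p a b s t" for a b s t
  proof -
    have "complex_of_real (p a b s t) = (\<Sum>l<k. \<Sum>l'<k. x s a l l' * cnj (y t b l l'))"
      unfolding pXY kronecker_form[OF Xpsd[unfolded hermitian_psd_def, THEN conjunct1]
          Ypsd[unfolded hermitian_psd_def, THEN conjunct1] \<psi>(1)] x_def y_def c_def
      unfolding K_def[symmetric]
      by (rule bilinear_form_compression[OF pos K])
    then have "Re (complex_of_real (p a b s t)) = G (Inl (s, a)) (Inr (t, b))"
      by (simp only: G_def Z_def sum.case prod.case)
    then show ?thesis by (simp add: M)
  qed
  moreover have "M \<in> doubly_nonnegative"
  proof -
    have "G v u = G u v" for u v
      by (simp add: G_def mult.commute)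
    then have "Finite_Cartesian_Product.transpose M = M"
      by (simp add: Finite_Cartesian_Product.transpose_def M_def)
    moreover have "0 \<le> inner w (M *v w)" for w
    proof -
      have "inner w (M *v w) = (\<Sum>u\<in>UNIV. \<Sum>v\<in>UNIV. vec_nth w u * vec_nth w v * G u v)"
        by (simp add: inner_vec_def matrix_vector_mult_def M sum_distrib_left mult_ac)
      also have "\<dots> = Re (\<Sum>l<k. \<Sum>l'<k. (\<Sum>u\<in>UNIV. of_real (vec_nth w u) * Z u l l') *
          cnj (\<Sum>v\<in>UNIV. of_real (vec_nth w v) * Z v l l'))"
        unfolding G_def by (rule gram_bilinear)
      \<comment> \<open>Each summand is a complex number times its own conjugate.\<close>
      also have "\<dots> \<ge> 0"
        unfolding Re_sum by (intro sum_nonneg) (simp only: complex_mult_cnj Re_complex_of_real, simp)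
      finally show ?thesis .
    qed
    moreover have "0 \<le> vec_nth (vec_nth M u) v" for u v
      unfolding M G_def by (rule psd_frobenius_nonneg[OF Zpsd Zpsd])
    ultimately show ?thesis by (simp add: doubly_nonnegative_def)
  qed
  ultimately show "p \<in> Corr doubly_nonnegative"
    unfolding Corr_def by blast
qed

section \<open>Zeros of the quadratic form and nonsignaling\<close>

text \<open>Moving from \<open>d\<close> a small step against \<open>w\<close> = M d changes the
  form to first order by a negative multiple of the squared norm of \<open>w\<close>. As the form is
  zero at \<open>d\<close> and never negative, \<open>w\<close> must vanish.\<close>

lemma psd_form_zero_imp_kernel:
  fixes M :: "real ^ 'n ^ 'n::finite"
  assumes sym: "Finite_Cartesian_Product.transpose M = M" and psd: "\<And>v. 0 \<le> inner v (M *v v)"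
    and zero: "inner d (M *v d) = 0"
  shows "M *v d = 0"
proof -
  define w where "w = M *v d"
  define q where "q = inner w (M *v w)"
  have dMw: "inner d (M *v w) = inner w w"
    using dot_lmul_matrix[of d M w] sym by (simp add: w_def vector_transpose_matrix[symmetric])
  have q: "0 \<le> q" unfolding q_def by (rule psd)
  \<comment> \<open>For positive \<open>q\<close> the minimum over the step length is at minus
    \<open>inner w w / q\<close>; the denominator \<open>q + 1\<close> also covers
    \<open>q = 0\<close> and still makes the value negative unless \<open>w\<close> is zero.\<close>
  define e where "e = - inner w w / (q + 1)"
  have "0 \<le> inner (d + e *\<^sub>R w) (M *v (d + e *\<^sub>R w))" by (rule psd)
  also have "\<dots> = 2 * e * inner w w + e * e * q"
    using zero dMw
    by (simp add: matrix_vector_right_distrib matrix_vector_mult_scaleR inner_add_left inner_add_right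
        q_def w_def[symmetric] algebra_simps)
  also have "\<dots> = - (inner w w)\<^sup>2 * (q + 2) / (q + 1)\<^sup>2"
    using q by (simp add: e_def divide_simps power2_eq_square) (simp add: algebra_simps)
  finally have "(inner w w)\<^sup>2 * (q + 2) / (q + 1)\<^sup>2 \<le> 0" by simp
  then have "inner w w = 0"
    using q by (auto simp: divide_le_0_iff mult_le_0_iff)
  then show ?thesis by (simp add: w_def)
qed

lemma Corr_subset_nonsignaling:
  "Corr doubly_nonnegative
     \<subseteq> (nonsignaling_correlations :: ('a::finite, 'b::finite, 's::finite, 't::finite) correlation set)"
proof
  fix p :: "('a, 'b, 's, 't) correlation"
  assume "p \<in> Corr doubly_nonnegative"
  then obtain M :: "real ^ ('a, 'b, 's, 't) block_index ^ ('a, 'b, 's, 't) block_index"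
    where sym: "Finite_Cartesian_Product.transpose M = M" and psd: "\<And>v. 0 \<le> inner v (M *v v)"
      and nonneg: "\<And>u v. 0 \<le> vec_nth (vec_nth M u) v"
      and blocks: "\<And>i j. block_sum i j M = 1"
      and p: "\<And>a b s t. vec_nth (vec_nth M (Inl (s, a))) (Inr (t, b)) = p a b s t"
    unfolding Corr_def doubly_nonnegative_def by blast
  define e :: "'s + 't \<Rightarrow> real ^ ('a, 'b, 's, 't) block_index"
    where "e i = (\<chi> u. of_bool (u \<in> block i))" for i
  have Me: "vec_nth (M *v e i) u = (\<Sum>v\<in>block i. vec_nth (vec_nth M u) v)" for i u
    by (simp add: e_def matrix_vector_mult_def of_bool_def if_distrib sum.If_cases cong: if_cong)
  have eMe: "inner (e i) (M *v e j) = 1" for i j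
  proof -
    have "inner (e i) (M *v e j) = block_sum i j M"
      unfolding inner_vec_def Me block_sum_def
      by (rule sum.mono_neutral_cong_right) (auto simp: e_def)
    then show ?thesis by (simp add: blocks)
  qed
  \<comment> \<open>The four block sums contribute 1 - 1 - 1 + 1, so the form vanishes at the
    difference.\<close>
  have "M *v (e i - e j) = 0" for i j
    by (rule psd_form_zero_imp_kernel[OF sym psd])
      (simp add: matrix_vector_mult_diff_distrib inner_diff_left inner_diff_right eMe)
  then have "M *v e i = M *v e j" for i j
    by (simp add: matrix_vector_mult_diff_distrib)
  then have row: "(\<Sum>v\<in>block i. vec_nth (vec_nth M u) v) = (\<Sum>v\<in>block j. vec_nth (vec_nth M u) v)" for i j u
    by (metis Me)
  have symM: "vec_nth (vec_nth M u) v = vec_nth (vec_nth M v) u" for u v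
    using arg_cong[OF sym, of "\<lambda>N. vec_nth (vec_nth N u) v"]
    by (simp add: Finite_Cartesian_Product.transpose_def)
  \<comment> \<open>The marginal is the sum of row \<open>Inl (s, a)\<close> over the block of
    \<open>t\<close>, which is the same for every block.\<close>
  have "(\<Sum>b\<in>UNIV. p a b s t) = (\<Sum>b\<in>UNIV. p a b s t')" for a s t t'
    using row[of "Inl (s, a)" "Inr t" "Inr t'"] by (simp add: sum_block p del: block.simps)
  \<comment> \<open>Here the row belongs to \<open>Inr (t, b)\<close>; symmetry identifies its
    entries with the values of \<open>p\<close>, which are prescribed only in the rows of the first
    party.\<close>
  moreover have "(\<Sum>a\<in>UNIV. p a b s t) = (\<Sum>a\<in>UNIV. p a b s' t)" for b t s s'
    using row[of "Inr (t, b)" "Inl s" "Inl s'"]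
    by (simp add: sum_block symM[of "Inr (t, b)"] p del: block.simps)
  moreover have "0 \<le> p a b s t" for a b s t
    by (simp add: p[symmetric] nonneg)
  moreover have "(\<Sum>a\<in>UNIV. \<Sum>b\<in>UNIV. p a b s t) = 1" for s t
    using blocks[of "Inl s" "Inr t"] by (simp add: block_sum_def sum_block p del: block.simps)
  ultimately show "p \<in> nonsignaling_correlations"
    unfolding nonsignaling_correlations_def prob_correlations_def by blast
qed

theorem proposition3p11:
  shows "(quantum_correlations ::
            ('a::finite, 'b::finite, 's::finite, 't::finite) correlation set)
           \<subseteq> Corr doubly_nonnegative
         \<and> Corr doubly_nonnegative
           \<subseteq> (nonsignaling_correlations :: ('a, 'b, 's, 't) correlation set)"
  using quantum_subset_Corr Corr_subset_nonsignaling by blast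

end
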